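(* Let $p$ be a prime, let $d \ge 1$ be an integer, let $S$ be a non-empty subset of $\mathbb{F}_p$, and let $n$ be a positive integer. If $P:\mathbb{F}_p^n \to \mathbb{F}_p$ is a polynomial with degree at most $d$ and $P(S^n)$ does not contain the image $A(S)$ of $S$ by any non-constant polynomial $A:\mathbb{F}_p \to \mathbb{F}_p$ with degree at most $d$, then $P$ coincides on $S^n$ with a constant polynomial. *)

theory Defs
  imports
    "HOL-Analysis.Finite_Cartesian_Product"
    "HOL-Library.Poly_Mapping"
    "HOL-Computational_Algebra.Polynomial"
    "HOL-Computational_Algebra.Fundamental_Theorem_Algebra"
    "Berlekamp_Zassenhaus.Finite_Field"
begin

text \<open>
  Formal polynomials over \<open>'a\<close> in the finitely many variables \<open>x\<^sub>i\<close>, \<open>i :: 'n\<close>: a monomial is its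
  exponent function \<open>'n \<Rightarrow>\<^sub>0 nat\<close>, and a polynomial maps each monomial to its coefficient.
\<close>

type_synonym ('n, 'a) mpoly = "('n \<Rightarrow>\<^sub>0 nat) \<Rightarrow>\<^sub>0 'a"

definition mpoly_eval :: "('n::finite, 'a::comm_semiring_1) mpoly \<Rightarrow> 'a ^ 'n \<Rightarrow> 'a" where
  "mpoly_eval Q x =
     (\<Sum>m\<in>Poly_Mapping.keys Q.
        Poly_Mapping.lookup Q m * (\<Prod>i\<in>UNIV. (x $ i) ^ Poly_Mapping.lookup m i))"

text \<open>Total degree at most \<open>d\<close>; the zero polynomial satisfies this for every \<open>d\<close>.\<close>

definition total_degree_le :: "nat \<Rightarrow> ('n::finite, 'a::zero) mpoly \<Rightarrow> bool" where
  "total_degree_le d Q \<longleftrightarrow>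
     (\<forall>m\<in>Poly_Mapping.keys Q. (\<Sum>i\<in>UNIV. Poly_Mapping.lookup m i) \<le> d)"

text \<open>
  Over a finite field distinct formal polynomials can induce the same function; a function has
  degree at most \<open>d\<close> if some formal polynomial of total degree at most \<open>d\<close> induces it.
\<close>

definition polynomial_map_le :: "nat \<Rightarrow> ('a::comm_semiring_1 ^ 'n::finite \<Rightarrow> 'a) \<Rightarrow> bool" where
  "polynomial_map_le d P \<longleftrightarrow> (\<exists>Q. total_degree_le d Q \<and> P = mpoly_eval Q)"

definition vec_power :: "'a set \<Rightarrow> ('a ^ 'n) set" where
  "vec_power S = {x. \<forall>i. x $ i \<in> S}"

end

theory Submission
  imports Defs
begin

text \<open>
  Move between two points of the grid \<open>S\<^sup>n\<close> by changing one coordinate at a time; every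
  intermediate point stays in the grid, so if \<open>P\<close> is not constant on \<open>S\<^sup>n\<close>, one of these steps
  changes its value (\<open>constant_on_vec_powerI\<close>). Along the axis-parallel line carrying that step,
  \<open>P\<close> is a univariate polynomial \<open>A\<close> of degree at most \<open>d\<close> (\<open>polynomial_map_le_axis_line\<close>). It is
  non-constant because it takes different values at the two ends of the step, and it maps \<open>S\<close>
  into \<open>P(S\<^sup>n)\<close> because the points of the line with parameter in \<open>S\<close> belong to the grid. This is
  exactly the kind of polynomial that the hypothesis excludes.
\<close>

definition replace_coord :: "'a ^ 'n \<Rightarrow> 'n \<Rightarrow> 'a \<Rightarrow> 'a ^ 'n" where
  "replace_coord x i t = (\<chi> j. if j = i then t else x $ j)"

lemma replace_coord_nth [simp]:
  "replace_coord x i t $ j = (if j = i then t else x $ j)"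
  by (simp add: replace_coord_def)

lemma replace_coord_self [simp]: "replace_coord x i (x $ i) = x"
  by (simp add: vec_eq_iff)

lemma replace_coord_in_vec_power:
  "x \<in> vec_power S \<Longrightarrow> t \<in> S \<Longrightarrow> replace_coord x i t \<in> vec_power S"
  by (simp add: vec_power_def)

text \<open>
  On the line every coordinate except the \<open>i\<close>-th is a scalar, so a monomial \<open>m\<close> becomes a scalar
  times \<open>t\<close> to the power \<open>m i\<close>, and this exponent is at most the total degree of \<open>m\<close>.
\<close>

lemma polynomial_map_le_axis_line:
  fixes P :: "'a::comm_semiring_1 ^ 'n::finite \<Rightarrow> 'a"
  assumes "polynomial_map_le d P"
  obtains A where "Polynomial.degree A \<le> d" and "\<And>t. poly A t = P (replace_coord x i t)"
proof -
  from assms obtain Q where Q: "total_degree_le d Q" and P: "P = mpoly_eval Q"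
    by (auto simp: polynomial_map_le_def)
  define A where "A = (\<Sum>m\<in>Poly_Mapping.keys Q.
    Polynomial.monom (Poly_Mapping.lookup Q m * (\<Prod>j\<in>UNIV - {i}. (x $ j) ^ Poly_Mapping.lookup m j))
          (Poly_Mapping.lookup m i))"
  show thesis
  proof
    show "Polynomial.degree A \<le> d"
      unfolding A_def
    proof (rule degree_sum_le)
      fix m assume m: "m \<in> Poly_Mapping.keys Q"
      have "Poly_Mapping.lookup m i \<le> (\<Sum>j\<in>UNIV. Poly_Mapping.lookup m j)"
        by (rule member_le_sum) auto
      also have "\<dots> \<le> d"
        using Q m by (simp add: total_degree_le_def)
      finally show "Polynomial.degree (Polynomial.monom (Poly_Mapping.lookup Q m *
          (\<Prod>j\<in>UNIV - {i}. (x $ j) ^ Poly_Mapping.lookup m j)) (Poly_Mapping.lookup m i)) \<le> d"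
        using degree_monom_le order_trans by blast
    qed simp
    fix t
    have "(\<Prod>j\<in>UNIV. (replace_coord x i t $ j) ^ Poly_Mapping.lookup m j) =
        t ^ Poly_Mapping.lookup m i * (\<Prod>j\<in>UNIV - {i}. (x $ j) ^ Poly_Mapping.lookup m j)"
      for m :: "'n \<Rightarrow>\<^sub>0 nat"
      by (subst prod.remove[of _ i]) (auto intro!: prod.cong)
    then show "poly A t = P (replace_coord x i t)"
      by (simp add: A_def P mpoly_eval_def poly_sum poly_monom ac_simps)
  qed
qed

text \<open>
  The induction is on the set of coordinates in which the two points may differ. Correcting the
  coordinate \<open>i\<close> of \<open>x\<close> to that of \<open>y\<close> costs one admissible step and keeps the point in the grid.
\<close>

lemma constant_on_vec_powerI:
  fixes f :: "'a ^ 'n::finite \<Rightarrow> 'b"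
  assumes step: "\<And>x i t. x \<in> vec_power S \<Longrightarrow> t \<in> S \<Longrightarrow> f (replace_coord x i t) = f x"
    and "x \<in> vec_power S" and y: "y \<in> vec_power S"
  shows "f x = f y"
proof -
  have "f x = f y" if "finite T" "x \<in> vec_power S" "\<And>j. j \<notin> T \<Longrightarrow> x $ j = y $ j"
    for T :: "'n set" and x
    using that
  proof (induction T arbitrary: x rule: finite_induct)
    case empty
    then have "x = y" by (simp add: vec_eq_iff)
    then show ?case by simp
  next
    case (insert i T)
    have yi: "y $ i \<in> S" using y by (simp add: vec_power_def)
    have "f (replace_coord x i (y $ i)) = f y"
      using insert.prems yi by (intro insert.IH) (auto simp: replace_coord_in_vec_power)
    then show ?case
      using step[OF insert.prems(1) yi] by simp
  qed
  from this[of UNIV x] \<open>x \<in> vec_power S\<close> show ?thesis by simp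
qed

theorem proposition1p12:
  fixes S :: "'p::prime_card mod_ring set"
    and P :: "'p mod_ring ^ 'n::finite \<Rightarrow> 'p mod_ring"
    and d :: nat
  assumes "d \<ge> 1"
    and "S \<noteq> {}"
    and "polynomial_map_le d P"
    and "\<And>A :: 'p mod_ring poly.
           Polynomial.degree A \<le> d \<Longrightarrow> \<not> constant (poly A) \<Longrightarrow>
           \<not> poly A ` S \<subseteq> P ` vec_power S"
  shows "\<exists>c. \<forall>x\<in>vec_power S. P x = c"
proof -
  have "P (replace_coord x i t) = P x" if x: "x \<in> vec_power S" and t: "t \<in> S" for x i t
  proof (rule ccontr)
    assume neq: "P (replace_coord x i t) \<noteq> P x"
    obtain A where deg: "Polynomial.degree A \<le> d" and A: "\<And>s. poly A s = P (replace_coord x i s)"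
      by (rule polynomial_map_le_axis_line[OF assms(3), of x i]) blast
    have "poly A t \<noteq> poly A (x $ i)"
      using neq by (simp add: A)
    then have "\<not> constant (poly A)"
      unfolding constant_def by blast
    moreover have "poly A ` S \<subseteq> P ` vec_power S"
      using x by (auto simp: A replace_coord_in_vec_power)
    ultimately show False
      using assms(4) deg by blast
  qed
  then have "P x = P y" if "x \<in> vec_power S" "y \<in> vec_power S" for x y
    by (rule constant_on_vec_powerI[OF _ that])
  then show ?thesis by blast
qed

end
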